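(* For any partial function $f\colon\{0,1\}^n\to\{0,1,\perp\}$ with $F(x,y)=f(x\oplus y)$, if $\mathrm{NADT^{\oplus}}(f)\ge n-1$, then $\mathrm{D_{cc}^{\rightarrow}}(F)=\mathrm{NADT^{\oplus}}(f)$.
   Context: $\operatorname{Dom}(f)=f^{-1}(\{0,1\})$, $\oplus$ is bitwise XOR, $\operatorname{Dom}(F)=\{(x,y):x\oplus y\in\operatorname{Dom}(f)\}$. $\mathrm{D_{cc}^{\rightarrow}}(F)$ is the minimum $t$ such that there are total $h\colon\{0,1\}^n\to\{0,1\}^t$ and $\varphi\colon\{0,1\}^t\times\{0,1\}^n\to\{0,1\}$ with $\varphi(h(x),y)=F(x,y)$ for all $(x,y)\in\operatorname{Dom}(F)$. With $\langle s,x\rangle=\bigoplus_is_i\wedge x_i$, $\mathrm{NADT^{\oplus}}(f)$ is the minimum $p$ such that there are $s_1,\dots,s_p\in\{0,1\}^n$ and total $l\colon\{0,1\}^p\to\{0,1\}$ with $l(\langle s_1,x\rangle,\dots,\langle s_p,x\rangle)=f(x)$ for all $x\in\operatorname{Dom}(f)$. *)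

theory Defs
  imports Main
begin

text \<open>
  Points of the Boolean cube are Boolean lists of length \<open>n\<close>, with \<open>True\<close> for 1. A partial
  function is option-valued, with \<open>None\<close> for the value ``undefined''; its values on lists of
  length other than \<open>n\<close> are never consulted.
\<close>

definition cube :: "nat \<Rightarrow> bool list set" where
  "cube n = {x. length x = n}"

definition xor_vec :: "bool list \<Rightarrow> bool list \<Rightarrow> bool list" (infixl "\<oplus>\<^sub>v" 65) where
  "x \<oplus>\<^sub>v y = map2 (\<noteq>) x y"

text \<open>On type \<open>bool\<close>, disequality is exclusive or.\<close>

definition parity :: "bool list \<Rightarrow> bool list \<Rightarrow> bool" where
  "parity s x = foldr (\<noteq>) (map2 (\<and>) s x) False"

definition Dom :: "nat \<Rightarrow> (bool list \<Rightarrow> bool option) \<Rightarrow> bool list set" where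
  "Dom n f = {x \<in> cube n. f x \<noteq> None}"

definition Dom2 :: "nat \<Rightarrow> (bool list \<Rightarrow> bool list \<Rightarrow> bool option) \<Rightarrow> (bool list \<times> bool list) set" where
  "Dom2 n F = {(x, y) \<in> cube n \<times> cube n. F x y \<noteq> None}"

definition one_way_computable ::
    "nat \<Rightarrow> (bool list \<Rightarrow> bool list \<Rightarrow> bool option) \<Rightarrow> nat \<Rightarrow> bool" where
  "one_way_computable n F t \<longleftrightarrow>
     (\<exists>(h :: bool list \<Rightarrow> bool list) (\<phi> :: bool list \<Rightarrow> bool list \<Rightarrow> bool).
        h ` cube n \<subseteq> cube t \<and> (\<forall>(x, y) \<in> Dom2 n F. F x y = Some (\<phi> (h x) y)))"

definition D_cc_one_way :: "nat \<Rightarrow> (bool list \<Rightarrow> bool list \<Rightarrow> bool option) \<Rightarrow> nat" where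
  "D_cc_one_way n F = (LEAST t. one_way_computable n F t)"

definition parity_computable :: "nat \<Rightarrow> (bool list \<Rightarrow> bool option) \<Rightarrow> nat \<Rightarrow> bool" where
  "parity_computable n f p \<longleftrightarrow>
     (\<exists>(ss :: bool list list) (l :: bool list \<Rightarrow> bool).
        length ss = p \<and> set ss \<subseteq> cube n \<and>
        (\<forall>x \<in> Dom n f. f x = Some (l (map (\<lambda>s. parity s x) ss))))"

definition NADT_parity :: "nat \<Rightarrow> (bool list \<Rightarrow> bool option) \<Rightarrow> nat" where
  "NADT_parity n f = (LEAST p. parity_computable n f p)"

text \<open>Both minima range over nonempty sets, so \<open>LEAST\<close> is well defined.\<close>

lemma one_way_computable_n: "one_way_computable n F n"
  unfolding one_way_computable_def
  by (rule exI[of _ id], rule exI[of _ "\<lambda>x y. the (F x y)"]) (auto simp: Dom2_def)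

lemma parity_zeros: "parity (replicate (length x) False) x = False"
  unfolding parity_def by (induction x) auto

lemma parity_Cons: "parity (a # s) (b # x) = ((a \<and> b) \<noteq> parity s x)"
  by (simp add: parity_def)

lemma parity_basis:
  "\<exists>ss. length ss = n \<and> set ss \<subseteq> cube n \<and> (\<forall>x \<in> cube n. map (\<lambda>s. parity s x) ss = x)"
proof (induction n)
  case 0
  show ?case by (auto simp: cube_def)
next
  case (Suc n)
  then obtain ss where ss: "length ss = n" "set ss \<subseteq> cube n"
    "\<forall>x \<in> cube n. map (\<lambda>s. parity s x) ss = x" by blast
  define ts where "ts = (True # replicate n False) # map ((#) False) ss"
  have "map (\<lambda>s. parity s x) ts = x" if "x \<in> cube (Suc n)" for x
  proof -
    from that obtain b y where x: "x = b # y" and y: "length y = n"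
      by (auto simp: cube_def length_Suc_conv)
    have "map (\<lambda>s. parity s y) ss = y" using ss(3) y by (auto simp: cube_def)
    then show ?thesis using parity_zeros[of y] y
      by (simp add: ts_def x parity_Cons comp_def)
  qed
  moreover have "length ts = Suc n" "set ts \<subseteq> cube (Suc n)"
    using ss by (auto simp: ts_def cube_def)
  ultimately show ?case by blast
qed

lemma parity_computable_n: "parity_computable n f n"
proof -
  obtain ss where "length ss = n" "set ss \<subseteq> cube n"
    "\<forall>x \<in> cube n. map (\<lambda>s. parity s x) ss = x"
    using parity_basis by blast
  then show ?thesis unfolding parity_computable_def
    by (intro exI[of _ ss] exI[of _ "\<lambda>x. the (f x)"]) (auto simp: Dom_def)
qed

end

theory Submission imports Defs begin

text \<open>
  Let \<open>S\<close> be the set of all \<open>a \<oplus> b\<close> with \<open>f a = 0\<close> and \<open>f b = 1\<close>. A message function is a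
  colouring of the cube in which no two points of the same colour differ by an element of \<open>S\<close>,
  and a set of parities computes \<open>f\<close> iff its kernel avoids \<open>S\<close>. With fewer than \<open>2^n\<close>
  colours, two points share a colour and span a line avoiding \<open>S\<close>, so \<open>n - 1\<close> parities
  suffice. With at most \<open>2^(n-2)\<close> colours, three points share a colour; their three pairwise
  differences are the nonzero elements of a plane avoiding \<open>S\<close>, so \<open>n - 2\<close> parities suffice.
\<close>

section \<open>XOR on the cube and linearity of parities\<close>

lemma length_xor_vec [simp]: "length (x \<oplus>\<^sub>v y) = min (length x) (length y)"
  by (simp add: xor_vec_def)

lemma nth_xor_vec [simp]:
  "i < length x \<Longrightarrow> i < length y \<Longrightarrow> (x \<oplus>\<^sub>v y) ! i = (x ! i \<noteq> y ! i)"
  by (simp add: xor_vec_def)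

lemma xor_vec_in_cube [simp]: "x \<in> cube n \<Longrightarrow> y \<in> cube n \<Longrightarrow> x \<oplus>\<^sub>v y \<in> cube n"
  by (simp add: cube_def)

lemma xor_vec_cancel: "length x = length y \<Longrightarrow> x \<oplus>\<^sub>v (x \<oplus>\<^sub>v y) = y"
  by (rule nth_equalityI) auto

lemma xor_vec_eq_zero_iff:
  assumes "length x = length y"
  shows "x \<oplus>\<^sub>v y = replicate (length x) False \<longleftrightarrow> x = y"
  using assms by (auto simp: list_eq_iff_nth_eq)

lemma parity_xor_vec_right:
  "length x = length y \<Longrightarrow> parity s (x \<oplus>\<^sub>v y) = (parity s x \<noteq> parity s y)"
proof (induction x y arbitrary: s rule: list_induct2)
  case Nil
  show ?case by (simp add: parity_def xor_vec_def)
next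
  case (Cons a x b y)
  show ?case
  proof (cases s)
    case Nil
    then show ?thesis by (simp add: parity_def)
  next
    case (Cons c r)
    have "(a # x) \<oplus>\<^sub>v (b # y) = (a \<noteq> b) # (x \<oplus>\<^sub>v y)" by (simp add: xor_vec_def)
    then show ?thesis using Cons.IH[of r] \<open>s = c # r\<close> by (auto simp: parity_Cons)
  qed
qed

lemma parity_commute: "parity s x = parity x s"
  unfolding parity_def
  by (rule arg_cong[where f = "\<lambda>xs. foldr (\<noteq>) xs False"], rule nth_equalityI) auto

lemma parity_xor_vec_left:
  "length s = length r \<Longrightarrow> parity (s \<oplus>\<^sub>v r) x = (parity s x \<noteq> parity r x)"
  by (metis parity_commute parity_xor_vec_right)

section \<open>Small kernels of lists of parities\<close>

definition parity_kernel :: "nat \<Rightarrow> bool list list \<Rightarrow> bool list set" where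
  "parity_kernel n ss = {x \<in> cube n. \<forall>s \<in> set ss. \<not> parity s x}"

text \<open>If all coordinate parities vanish, so does the point. Avoiding \<open>S\<close> passes
  to subsets, so here and below an inclusion is all that is asked of a kernel.\<close>

lemma trivial_parity_kernel:
  obtains ss where "length ss = n" "set ss \<subseteq> cube n" "parity_kernel n ss \<subseteq> {replicate n False}"
proof -
  obtain ss where ss: "length ss = n" "set ss \<subseteq> cube n"
    "\<forall>x \<in> cube n. map (\<lambda>s. parity s x) ss = x"
    using parity_basis by blast
  have "x = replicate n False" if "x \<in> parity_kernel n ss" for x
  proof -
    have "x = map (\<lambda>s. parity s x) ss" using that ss(3) by (auto simp: parity_kernel_def)
    also have "\<dots> = map (\<lambda>s. False) ss" using that by (auto simp: parity_kernel_def)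
    finally show ?thesis using ss(1) by (simp add: map_replicate_const)
  qed
  then show ?thesis using ss that by blast
qed

text \<open>
  Pick \<open>r\<close> in the list with \<open>\<langle>r, v\<rangle> = 1\<close>, add \<open>r\<close> to every other parity that is 1 on \<open>v\<close>,
  and drop \<open>r\<close>.
\<close>

lemma parity_kernel_adjoin:
  assumes ss: "length ss = Suc p" "set ss \<subseteq> cube n"
    and v: "v \<in> cube n" "v \<notin> parity_kernel n ss"
  obtains ts where "length ts = p" "set ts \<subseteq> cube n"
    "parity_kernel n ts \<subseteq> parity_kernel n ss \<union> (\<oplus>\<^sub>v) v ` parity_kernel n ss"
proof -
  from v obtain r where r: "r \<in> set ss" "parity r v" by (auto simp: parity_kernel_def)
  define g where "g s = (if parity s v then s \<oplus>\<^sub>v r else s)" for s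
  define ts where "ts = map g (remove1 r ss)"
  have rc: "r \<in> cube n" using r ss by blast
  have lts: "length ts = p" using r ss by (simp add: ts_def length_remove1)
  have sts: "set ts \<subseteq> cube n"
    using ss(2) rc set_remove1_subset[of r ss] by (auto simp: ts_def g_def)
  have "x \<in> parity_kernel n ss \<union> (\<oplus>\<^sub>v) v ` parity_kernel n ss" if x: "x \<in> parity_kernel n ts" for x
  proof -
    have xc: "x \<in> cube n" using x by (simp add: parity_kernel_def)
    \<comment> \<open>To the parities in \<open>ss\<close>, the point \<open>x\<close> looks like
      \<open>v\<close> if \<open>r\<close> is 1 on \<open>x\<close>, and like 0 otherwise. So either
      the sum of \<open>v\<close> and \<open>x\<close>, or \<open>x\<close> itself, lies in the old
      kernel.\<close>
    have par: "parity s x = (parity s v \<and> parity r x)" if s: "s \<in> set ss" for s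
    proof (cases "s = r")
      case False
      then have "g s \<in> set ts" using s by (simp add: ts_def)
      then have "\<not> parity (g s) x" using x by (simp add: parity_kernel_def)
      moreover have "length s = length r" using s ss(2) rc by (auto simp: cube_def)
      ultimately show ?thesis by (auto simp: g_def parity_xor_vec_left split: if_splits)
    qed (use r in simp)
    show ?thesis
    proof (cases "parity r x")
      case True
      have len: "length v = length x" using v xc by (simp add: cube_def)
      have "v \<oplus>\<^sub>v x \<in> parity_kernel n ss"
        using v xc len par True by (auto simp: parity_kernel_def parity_xor_vec_right)
      moreover have "x = v \<oplus>\<^sub>v (v \<oplus>\<^sub>v x)" using xor_vec_cancel[OF len] by simp
      ultimately show ?thesis by blast
    next
      case False
      then show ?thesis using xc par by (auto simp: parity_kernel_def)
    qed
  qed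
  then show ?thesis using that lts sts by blast
qed

text \<open>Adjoining \<open>v\<close> to the trivial kernel costs one of the \<open>n\<close>
  parities.\<close>

lemma line_parity_kernel:
  assumes v: "v \<in> cube n" "v \<noteq> replicate n False"
  obtains ss where "length ss = n - 1" "set ss \<subseteq> cube n"
    "parity_kernel n ss \<subseteq> {replicate n False, v}"
proof -
  obtain ss where ss: "length ss = n" "set ss \<subseteq> cube n" "parity_kernel n ss \<subseteq> {replicate n False}"
    by (rule trivial_parity_kernel)
  \<comment> \<open>For \<open>n = 0\<close> the cube has only the zero point, so a nonzero
    \<open>v\<close> makes \<open>n - 1\<close> a true subtraction.\<close>
  have "n \<noteq> 0" using v by (auto simp: cube_def)
  then have "length ss = Suc (n - 1)" using ss by simp
  moreover have "v \<notin> parity_kernel n ss" using v ss by blast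
  ultimately obtain ts where ts: "length ts = n - 1" "set ts \<subseteq> cube n"
    "parity_kernel n ts \<subseteq> parity_kernel n ss \<union> (\<oplus>\<^sub>v) v ` parity_kernel n ss"
    using parity_kernel_adjoin[of ss "n - 1" n v] ss v by blast
  have "v \<oplus>\<^sub>v replicate n False = v"
    using v by (intro nth_equalityI) (auto simp: cube_def)
  then have "parity_kernel n ts \<subseteq> {replicate n False, v}" using ts(3) ss(3) by fastforce
  then show ?thesis using that ts by blast
qed

text \<open>A nonzero \<open>w\<close> different from \<open>v\<close> lies off the line through 0
  and \<open>v\<close>, so it can be adjoined to that line at the cost of one more parity.\<close>

lemma plane_parity_kernel:
  assumes v: "v \<in> cube n" "v \<noteq> replicate n False"
    and w: "w \<in> cube n" "w \<noteq> replicate n False" "w \<noteq> v"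
    and n: "n \<ge> 2"
  obtains ss where "length ss = n - 2" "set ss \<subseteq> cube n"
    "parity_kernel n ss \<subseteq> {replicate n False, v, w, w \<oplus>\<^sub>v v}"
proof -
  obtain ss where ss: "length ss = n - 1" "set ss \<subseteq> cube n"
    "parity_kernel n ss \<subseteq> {replicate n False, v}"
    using line_parity_kernel[OF v] by blast
  have "length ss = Suc (n - 2)" using ss n by simp
  moreover have "w \<notin> parity_kernel n ss" using w ss by blast
  ultimately obtain ts where ts: "length ts = n - 2" "set ts \<subseteq> cube n"
    "parity_kernel n ts \<subseteq> parity_kernel n ss \<union> (\<oplus>\<^sub>v) w ` parity_kernel n ss"
    using parity_kernel_adjoin[of ss "n - 2" n w] ss w by blast
  have "w \<oplus>\<^sub>v replicate n False = w"
    using w by (intro nth_equalityI) (auto simp: cube_def)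
  then have "parity_kernel n ts \<subseteq> {replicate n False, v, w, w \<oplus>\<^sub>v v}"
    using ts(3) ss(3) by fastforce
  then show ?thesis using that ts by blast
qed

section \<open>From kernels to parities, from parities to messages\<close>

text \<open>Two inputs with the same parities differ by a kernel element, so \<open>f\<close> is
  constant on the points of its domain that share a parity vector. The premise \<open>ker\<close>
  says that the kernel avoids \<open>S\<close>.\<close>

lemma parity_computable_if_kernel:
  assumes ss: "length ss = p" "set ss \<subseteq> cube n"
    and ker: "\<And>a b. a \<in> Dom n f \<Longrightarrow> b \<in> Dom n f \<Longrightarrow> a \<oplus>\<^sub>v b \<in> parity_kernel n ss \<Longrightarrow> f a = f b"
  shows "parity_computable n f p"
proof -
  let ?m = "\<lambda>x. map (\<lambda>s. parity s x) ss"
  \<comment> \<open>The value at any domain point with parity vector \<open>m\<close>; arbitrary if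
    there is none.\<close>
  define l where "l m = the (f (SOME x. x \<in> Dom n f \<and> ?m x = m))" for m
  have "f x = Some (l (?m x))" if x: "x \<in> Dom n f" for x
  proof -
    define z where "z = (SOME z. z \<in> Dom n f \<and> ?m z = ?m x)"
    have z: "z \<in> Dom n f" "?m z = ?m x"
      using someI[of "\<lambda>z. z \<in> Dom n f \<and> ?m z = ?m x" x] x by (auto simp: z_def)
    have "z \<oplus>\<^sub>v x \<in> parity_kernel n ss"
      using x z by (auto simp: parity_kernel_def Dom_def cube_def parity_xor_vec_right)
    then have "f z = f x" using ker x z by blast
    moreover have "l (?m x) = the (f z)" by (simp only: l_def z_def)
    ultimately show ?thesis using x by (auto simp: Dom_def)
  qed
  then show ?thesis using ss unfolding parity_computable_def by blast
qed

text \<open>Parities are additive: the sender transmits the parities of \<open>x\<close>, and the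
  receiver adds those of \<open>y\<close> to obtain the parities of the sum.\<close>

lemma one_way_computable_if_parity_computable:
  assumes F: "\<And>x y. x \<in> cube n \<Longrightarrow> y \<in> cube n \<Longrightarrow> F x y = f (x \<oplus>\<^sub>v y)"
    and "parity_computable n f p"
  shows "one_way_computable n F p"
proof -
  obtain ss l where ss: "length ss = p"
    "\<forall>x \<in> Dom n f. f x = Some (l (map (\<lambda>s. parity s x) ss))"
    using assms(2) unfolding parity_computable_def by blast
  let ?m = "\<lambda>x. map (\<lambda>s. parity s x) ss"
  have "F x y = Some (l (?m x \<oplus>\<^sub>v ?m y))" if "(x, y) \<in> Dom2 n F" for x y
  proof -
    have xy: "x \<in> cube n" "y \<in> cube n" "x \<oplus>\<^sub>v y \<in> Dom n f"
      using that F by (auto simp: Dom2_def Dom_def)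
    have "?m (x \<oplus>\<^sub>v y) = ?m x \<oplus>\<^sub>v ?m y"
      using xy by (intro nth_equalityI) (auto simp: cube_def parity_xor_vec_right)
    then show ?thesis using ss(2) xy F by metis
  qed
  then show ?thesis unfolding one_way_computable_def
    using ss(1) by (intro exI[of _ ?m] exI[of _ "\<lambda>m y. l (m \<oplus>\<^sub>v ?m y)"]) (auto simp: cube_def)
qed

text \<open>The differences of points with equal messages avoid \<open>S\<close>: a receiver holding
  the sum of \<open>u\<close> and \<open>a\<close> must answer \<open>f a\<close> if the sender has
  \<open>u\<close> and \<open>f b\<close> if the sender has \<open>u'\<close>, but sees the same
  message.\<close>

lemma same_message_imp_same_value:
  assumes F: "\<And>x y. x \<in> cube n \<Longrightarrow> y \<in> cube n \<Longrightarrow> F x y = f (x \<oplus>\<^sub>v y)"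
    and h: "\<forall>(x, y) \<in> Dom2 n F. F x y = Some (\<phi> (h x) y)"
    and u: "u \<in> cube n" "u' \<in> cube n" "h u = h u'"
    and ab: "a \<in> Dom n f" "b \<in> Dom n f" "a \<oplus>\<^sub>v b = u \<oplus>\<^sub>v u'"
  shows "f a = f b"
proof -
  have len: "length u = n" "length u' = n" "length a = n" "length b = n"
    using u ab by (auto simp: cube_def Dom_def)
  define y where "y = u \<oplus>\<^sub>v a"
  have y: "y \<in> cube n" using len by (simp add: y_def cube_def)
  have ua: "u \<oplus>\<^sub>v y = a" using len by (simp add: y_def xor_vec_cancel)
  have "u' \<oplus>\<^sub>v y = a \<oplus>\<^sub>v (u \<oplus>\<^sub>v u')"
    using len by (intro nth_equalityI) (auto simp: y_def)
  also have "\<dots> = b" using len ab(3) by (metis xor_vec_cancel)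
  finally have ub: "u' \<oplus>\<^sub>v y = b" .
  have "(u, y) \<in> Dom2 n F" "(u', y) \<in> Dom2 n F"
    using u y ua ub ab F by (auto simp: Dom2_def Dom_def)
  then have "F u y = Some (\<phi> (h u) y)" "F u' y = Some (\<phi> (h u') y)" using h by blast+
  then have "F u y = F u' y" using u(3) by simp
  then show ?thesis using F u y ua ub by simp
qed

section \<open>Counting points with the same message\<close>

lemma finite_cube [simp]: "finite (cube n)"
  using finite_lists_length_eq[of "UNIV :: bool set" n] by (simp add: cube_def)

lemma card_cube [simp]: "card (cube n) = 2 ^ n"
  using card_lists_length_eq[of "UNIV :: bool set" n] by (simp add: cube_def)

lemma parity_computable_minus_one:
  assumes F: "\<And>x y. x \<in> cube n \<Longrightarrow> y \<in> cube n \<Longrightarrow> F x y = f (x \<oplus>\<^sub>v y)"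
    and t: "one_way_computable n F t" "t < n"
  shows "parity_computable n f (n - 1)"
proof -
  obtain h \<phi> where h: "h ` cube n \<subseteq> cube t" "\<forall>(x, y) \<in> Dom2 n F. F x y = Some (\<phi> (h x) y)"
    using t(1) unfolding one_way_computable_def by blast
  have "card (h ` cube n) \<le> card (cube t)" using h by (intro card_mono) auto
  also have "\<dots> < card (cube n)" using t(2) by simp
  finally have "\<not> inj_on h (cube n)" by (rule pigeonhole)
  then obtain x y where xy: "x \<in> cube n" "y \<in> cube n" "x \<noteq> y" "h x = h y"
    by (auto simp: inj_on_def)
  have v: "x \<oplus>\<^sub>v y \<in> cube n" "x \<oplus>\<^sub>v y \<noteq> replicate n False"
    using xy xor_vec_eq_zero_iff[of x y] by (auto simp: cube_def)
  obtain ss where ss: "length ss = n - 1" "set ss \<subseteq> cube n"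
    "parity_kernel n ss \<subseteq> {replicate n False, x \<oplus>\<^sub>v y}"
    using line_parity_kernel[OF v] by blast
  show ?thesis
  proof (rule parity_computable_if_kernel[OF ss(1,2)])
    fix a b assume ab: "a \<in> Dom n f" "b \<in> Dom n f" "a \<oplus>\<^sub>v b \<in> parity_kernel n ss"
    \<comment> \<open>The zero difference means \<open>a = b\<close>; the other one comes from two
      points with the same message.\<close>
    then consider "a \<oplus>\<^sub>v b = replicate n False" | "a \<oplus>\<^sub>v b = x \<oplus>\<^sub>v y" using ss(3) by blast
    then show "f a = f b"
    proof cases
      case 1
      then show ?thesis using ab xor_vec_eq_zero_iff[of a b] by (auto simp: Dom_def cube_def)
    next
      case 2
      then show ?thesis using same_message_imp_same_value[OF F h(2) xy(1,2,4) ab(1,2)] by simp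
    qed
  qed
qed

lemma parity_computable_minus_two:
  assumes F: "\<And>x y. x \<in> cube n \<Longrightarrow> y \<in> cube n \<Longrightarrow> F x y = f (x \<oplus>\<^sub>v y)"
    and t: "one_way_computable n F t" "t + 2 \<le> n"
  shows "parity_computable n f (n - 2)"
proof -
  obtain h \<phi> where h: "h ` cube n \<subseteq> cube t" "\<forall>(x, y) \<in> Dom2 n F. F x y = Some (\<phi> (h x) y)"
    using t(1) unfolding one_way_computable_def by blast
  \<comment> \<open>With at most two points per message the cube would have at most
    \<open>2 ^ (t + 1)\<close> points, too few since \<open>t + 1 < n\<close>.\<close>
  have "\<exists>m \<in> cube t. card {x \<in> cube n. h x = m} \<ge> 3"
  proof (rule ccontr)
    assume "\<not> ?thesis"
    then have small: "card {x \<in> cube n. h x = m} \<le> 2" if "m \<in> cube t" for m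
      using that by (fastforce simp: not_le)
    have "card (cube n) \<le> card (\<Union>m \<in> cube t. {x \<in> cube n. h x = m})"
      using h(1) by (intro card_mono) auto
    also have "\<dots> \<le> (\<Sum>m \<in> cube t. card {x \<in> cube n. h x = m})"
      by (rule card_UN_le) simp
    also have "\<dots> \<le> (\<Sum>m \<in> cube t. 2)" using small by (rule sum_mono)
    also have "\<dots> = 2 ^ (t + 1)" by simp
    also have "\<dots> < 2 ^ n" using t(2) by (intro power_strict_increasing) auto
    finally show False by simp
  qed
  then obtain m where "card {x \<in> cube n. h x = m} \<ge> 3" by blast
  then obtain T where "T \<subseteq> {x \<in> cube n. h x = m}" "card T = 3"
    by (meson obtain_subset_with_card_n)
  then obtain x y z where xyz: "x \<in> cube n" "y \<in> cube n" "z \<in> cube n"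
    "x \<noteq> y" "x \<noteq> z" "y \<noteq> z" "h x = m" "h y = m" "h z = m"
    by (auto simp: card_3_iff)
  have len: "length x = n" "length y = n" "length z = n" using xyz by (auto simp: cube_def)
  have same: "h x = h y" "h x = h z" "h z = h y" using xyz by auto
  have v: "x \<oplus>\<^sub>v y \<in> cube n" "x \<oplus>\<^sub>v y \<noteq> replicate n False"
    and w: "x \<oplus>\<^sub>v z \<in> cube n" "x \<oplus>\<^sub>v z \<noteq> replicate n False"
    using xyz len xor_vec_eq_zero_iff[of x y] xor_vec_eq_zero_iff[of x z] by auto
  have wv: "x \<oplus>\<^sub>v z \<noteq> x \<oplus>\<^sub>v y" using xyz(6) len by (metis xor_vec_cancel)
  \<comment> \<open>The third nonzero element of the plane is the difference of the remaining pair,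
    which shares the message as well.\<close>
  have zy: "(x \<oplus>\<^sub>v z) \<oplus>\<^sub>v (x \<oplus>\<^sub>v y) = z \<oplus>\<^sub>v y"
    using len by (intro nth_equalityI) auto
  have "n \<ge> 2" using t(2) by simp
  then obtain ss where ss: "length ss = n - 2" "set ss \<subseteq> cube n"
    "parity_kernel n ss \<subseteq> {replicate n False, x \<oplus>\<^sub>v y, x \<oplus>\<^sub>v z, z \<oplus>\<^sub>v y}"
    using plane_parity_kernel[OF v w wv] zy by metis
  show ?thesis
  proof (rule parity_computable_if_kernel[OF ss(1,2)])
    fix a b assume ab: "a \<in> Dom n f" "b \<in> Dom n f" "a \<oplus>\<^sub>v b \<in> parity_kernel n ss"
    then consider "a \<oplus>\<^sub>v b = replicate n False" | "a \<oplus>\<^sub>v b = x \<oplus>\<^sub>v y"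
      | "a \<oplus>\<^sub>v b = x \<oplus>\<^sub>v z" | "a \<oplus>\<^sub>v b = z \<oplus>\<^sub>v y"
      using ss(3) by blast
    then show "f a = f b"
    proof cases
      case 1
      then show ?thesis using ab xor_vec_eq_zero_iff[of a b] by (auto simp: Dom_def cube_def)
    next
      case 2
      then show ?thesis
        using same_message_imp_same_value[OF F h(2) xyz(1,2) same(1) ab(1,2)] by simp
    next
      case 3
      then show ?thesis
        using same_message_imp_same_value[OF F h(2) xyz(1,3) same(2) ab(1,2)] by simp
    next
      case 4
      then show ?thesis
        using same_message_imp_same_value[OF F h(2) xyz(3,2) same(3) ab(1,2)] by simp
    qed
  qed
qed

theorem theorem34:
  fixes n :: nat
    and f :: "bool list \<Rightarrow> bool option"
    and F :: "bool list \<Rightarrow> bool list \<Rightarrow> bool option"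
  assumes "\<And>x y. x \<in> cube n \<Longrightarrow> y \<in> cube n \<Longrightarrow> F x y = f (x \<oplus>\<^sub>v y)"
    and "int (NADT_parity n f) \<ge> int n - 1"
  shows "D_cc_one_way n F = NADT_parity n f"
  unfolding D_cc_one_way_def
proof (rule Least_equality)
  have "parity_computable n f (NADT_parity n f)"
    unfolding NADT_parity_def by (rule LeastI[OF parity_computable_n])
  then show "one_way_computable n F (NADT_parity n f)"
    by (intro one_way_computable_if_parity_computable[of n F f]) (simp_all add: assms(1))
next
  fix t assume t: "one_way_computable n F t"
  have min: "NADT_parity n f \<le> p" if "parity_computable n f p" for p
    unfolding NADT_parity_def using that by (rule Least_le)
  show "NADT_parity n f \<le> t"
  proof (rule ccontr)
    assume less: "\<not> NADT_parity n f \<le> t"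
    \<comment> \<open>The bounds tighten in two rounds: the parity minimum is at most
      \<open>n\<close>, so \<open>t < n\<close>; then it is at most \<open>n - 1\<close>, so
      \<open>t\<close> is at most \<open>n - 2\<close>, and three points share a message.\<close>
    then have "t < n" using min[OF parity_computable_n] by simp
    then have "NADT_parity n f \<le> n - 1"
      by (intro min parity_computable_minus_one[OF assms(1) t])
    then have t2: "t + 2 \<le> n" using less by simp
    then have "NADT_parity n f \<le> n - 2"
      by (intro min parity_computable_minus_two[OF assms(1) t])
    then show False using assms(2) t2 by linarith
  qed
qed

end
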